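(* Let $G$ be a connected graph with at least one edge. For any integers $b\ge1$ and $c\ge1$, $T_G(b)\ge b+c$ if and only if $\chi_c(G)\le b+c$.
   Context: A vertex cover of $G$ is a set $S$ of vertices such that $V(G)\setminus S$ is independent. For a family (with repetitions allowed) $S_1,\dots,S_t$ of vertex covers, its budget is $\max_{v}|\{i:v\in S_i\}|$; $T_G(b)$ is the largest $t$ such that some family of $t$ vertex covers of $G$ has budget at most $b$. The lexicographic product $G\cdot K_c$ has vertex set $V(G)\times[c]$, with distinct $(u,a)$ and $(v,b')$ adjacent iff $uv\in E(G)$ or $u=v$. The $c$-fold chromatic number is $\chi_c(G) = \chi(G\cdot K_c)$. *)

theory Defs
  imports "Graph_Theory.Digraph_Component"
begin

text \<open>
  Finite simple graphs are represented by the locale \<open>pair_graph\<close>: the arc relation is finite,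
  irreflexive and symmetric, so an edge \<open>uv\<close> is the pair of arcs \<open>(u, v)\<close>, \<open>(v, u)\<close>.
\<close>

definition independent_set :: "'a pair_pre_digraph \<Rightarrow> 'a set \<Rightarrow> bool" where
  "independent_set G I \<longleftrightarrow> I \<subseteq> pverts G \<and> (\<forall>u\<in>I. \<forall>v\<in>I. (u, v) \<notin> parcs G)"

definition vertex_cover :: "'a pair_pre_digraph \<Rightarrow> 'a set \<Rightarrow> bool" where
  "vertex_cover G S \<longleftrightarrow> S \<subseteq> pverts G \<and> independent_set G (pverts G - S)"

text \<open>
  A family \<open>S\<^sub>1, \<dots>, S\<^sub>t\<close> is a function \<open>S\<close> of which only the values on \<open>{1..t}\<close> matter.
  The maximum is meaningful because the vertex set is assumed finite and nonempty.
\<close>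

definition budget :: "'a pair_pre_digraph \<Rightarrow> nat \<Rightarrow> (nat \<Rightarrow> 'a set) \<Rightarrow> nat" where
  "budget G t S = Max ((\<lambda>v. card {i \<in> {1..t}. v \<in> S i}) ` pverts G)"

text \<open>
  If \<open>G\<close> has an edge, one of its ends lies in at least half of the covers, so \<open>t \<le> 2 * b\<close> for
  every family below and the greatest such \<open>t\<close> exists (\<open>t = 0\<close> is always possible). For edgeless
  graphs the value is unspecified.
\<close>

definition max_covers :: "'a pair_pre_digraph \<Rightarrow> nat \<Rightarrow> nat" where
  "max_covers G b =
     (GREATEST t. \<exists>S. (\<forall>i\<in>{1..t}. vertex_cover G (S i)) \<and> budget G t S \<le> b)"

definition lex_product_complete ::
    "'a pair_pre_digraph \<Rightarrow> nat \<Rightarrow> ('a \<times> nat) pair_pre_digraph" where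
  "lex_product_complete G c =
     \<lparr> pverts = pverts G \<times> {1..c},
       parcs = {((u, a), (v, b)).
         (u, a) \<in> pverts G \<times> {1..c} \<and> (v, b) \<in> pverts G \<times> {1..c} \<and>
         (u, a) \<noteq> (v, b) \<and> ((u, v) \<in> parcs G \<or> u = v)} \<rparr>"

definition proper_coloring :: "'a pair_pre_digraph \<Rightarrow> nat \<Rightarrow> ('a \<Rightarrow> nat) \<Rightarrow> bool" where
  "proper_coloring G k f \<longleftrightarrow>
     f ` pverts G \<subseteq> {1..k} \<and> (\<forall>(u, v) \<in> parcs G. f u \<noteq> f v)"

definition chromatic_number :: "'a pair_pre_digraph \<Rightarrow> nat" where
  "chromatic_number G = (LEAST k. \<exists>f. proper_coloring G k f)"

definition fold_chromatic_number :: "nat \<Rightarrow> 'a pair_pre_digraph \<Rightarrow> nat" where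
  "fold_chromatic_number c G = chromatic_number (lex_product_complete G c)"

end

(*
  A cover family and a c-fold coloring are complementary: the colors given to the c copies of v are
  indices i with v outside S i. If each vertex lies in at most b of b + c covers, then it lies
  outside at least c of them, and c of these indices can serve as its colors. Conversely, the
  vertices that do not use a given color form a cover, and each vertex misses exactly b colors.
  The existence of families is inherited by smaller sizes and the existence of colorings by larger
  ones, which reduces the statement about the two extremal values to this correspondence.
*)
theory Submission
  imports Defs
begin

text \<open>The predicate under \<open>GREATEST\<close> in \<open>max_covers\<close>, named so that
  its boundedness and its inheritance by smaller sizes can be treated apart from the extremal
  value.\<close>

definition has_cover_family :: "'a pair_pre_digraph \<Rightarrow> nat \<Rightarrow> nat \<Rightarrow> bool" where
  "has_cover_family G b t \<longleftrightarrow> (\<exists>S. (\<forall>i\<in>{1..t}. vertex_cover G (S i)) \<and> budget G t S \<le> b)"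

lemma budget_le_iff:
  assumes "finite (pverts G)" and "pverts G \<noteq> {}"
  shows "budget G t S \<le> b \<longleftrightarrow> (\<forall>v\<in>pverts G. card {i \<in> {1..t}. v \<in> S i} \<le> b)"
  using assms by (auto simp: budget_def)

text \<open>Keeping only the first \<open>s\<close> covers of a family cannot raise any vertex
  count.\<close>

lemma has_cover_family_antimono:
  assumes "finite (pverts G)" and "pverts G \<noteq> {}" and "has_cover_family G b t" and "s \<le> t"
  shows "has_cover_family G b s"
proof -
  obtain S where cover: "\<forall>i\<in>{1..t}. vertex_cover G (S i)" and bud: "budget G t S \<le> b"
    using assms(3) by (auto simp: has_cover_family_def)
  have "card {i \<in> {1..s}. v \<in> S i} \<le> b" if "v \<in> pverts G" for v
  proof -
    have "card {i \<in> {1..s}. v \<in> S i} \<le> card {i \<in> {1..t}. v \<in> S i}"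
      using assms(4) by (intro card_mono) auto
    also have "\<dots> \<le> b"
      using bud that by (simp add: budget_le_iff[OF assms(1,2)])
    finally show ?thesis .
  qed
  then have "budget G s S \<le> b"
    by (simp add: budget_le_iff[OF assms(1,2)])
  moreover have "\<forall>i\<in>{1..s}. vertex_cover G (S i)"
    using cover assms(4) by auto
  ultimately show ?thesis
    by (auto simp: has_cover_family_def)
qed

lemma vertex_cover_arc:
  assumes "vertex_cover G S" and "(u, v) \<in> parcs G" and "u \<in> pverts G" and "v \<in> pverts G"
  shows "u \<in> S \<or> v \<in> S"
  using assms by (auto simp: vertex_cover_def independent_set_def)

text \<open>Every cover contains an end of the arc, so the index sets of the two ends together
  exhaust \<open>{1..t}\<close>, and each has at most \<open>b\<close> elements. This bound is what
  makes \<open>GREATEST\<close> meaningful.\<close>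

lemma has_cover_family_le:
  assumes "finite (pverts G)" and "(u, v) \<in> parcs G" and "u \<in> pverts G" and "v \<in> pverts G"
    and "has_cover_family G b t"
  shows "t \<le> 2 * b"
proof -
  have ne: "pverts G \<noteq> {}"
    using assms(3) by auto
  obtain S where cover: "\<forall>i\<in>{1..t}. vertex_cover G (S i)" and bud: "budget G t S \<le> b"
    using assms(5) by (auto simp: has_cover_family_def)
  have "{1..t} = {i \<in> {1..t}. u \<in> S i} \<union> {i \<in> {1..t}. v \<in> S i}"
    using vertex_cover_arc[OF _ assms(2-4)] cover by blast
  then have "t \<le> card {i \<in> {1..t}. u \<in> S i} + card {i \<in> {1..t}. v \<in> S i}"
    by (metis card_Un_le card_atLeastAtMost diff_Suc_1)
  also have "\<dots> \<le> b + b"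
    using bud assms(3,4) by (intro add_mono) (simp_all add: budget_le_iff[OF assms(1) ne])
  finally show ?thesis by simp
qed

text \<open>The admissible sizes are nonempty and bounded, so the greatest one is attained;
  truncation then reaches every smaller size.\<close>

lemma max_covers_ge_iff:
  assumes "finite (pverts G)" and "(u, v) \<in> parcs G" and "u \<in> pverts G" and "v \<in> pverts G"
  shows "max_covers G b \<ge> t \<longleftrightarrow> has_cover_family G b t"
proof -
  have ne: "pverts G \<noteq> {}"
    using assms(3) by auto
  have bound: "\<forall>s. has_cover_family G b s \<longrightarrow> s \<le> 2 * b"
    using has_cover_family_le[OF assms] by blast
  have max: "max_covers G b = (GREATEST s. has_cover_family G b s)"
    by (simp add: max_covers_def has_cover_family_def)
  \<comment> \<open>The empty family: \<open>{1..0}\<close> is empty, so every count is 0.\<close>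
  have "has_cover_family G b 0"
    by (simp add: has_cover_family_def budget_le_iff[OF assms(1) ne])
  then have "has_cover_family G b (max_covers G b)"
    unfolding max using bound by (metis (no_types, lifting) GreatestI_nat)
  moreover have "s \<le> max_covers G b" if "has_cover_family G b s" for s
    unfolding max using bound that by (metis (no_types, lifting) Greatest_le_nat)
  ultimately show ?thesis
    using has_cover_family_antimono[OF assms(1) ne] by blast
qed

lemma proper_coloring_mono:
  "proper_coloring G k f \<Longrightarrow> k \<le> l \<Longrightarrow> proper_coloring G l f"
  by (fastforce simp: proper_coloring_def)

text \<open>Giving all vertices different colors suffices, since arcs join distinct vertices. It
  guarantees that the \<open>LEAST\<close> in \<open>chromatic_number\<close> is attained.\<close>

lemma ex_proper_coloring:
  assumes "finite (pverts G)"
    and "\<And>u v. (u, v) \<in> parcs G \<Longrightarrow> u \<in> pverts G \<and> v \<in> pverts G \<and> u \<noteq> v"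
  shows "\<exists>k f. proper_coloring G k f"
proof -
  obtain f where "bij_betw f (pverts G) {1..card (pverts G)}"
    using assms(1) finite_same_card_bij[of "pverts G" "{1..card (pverts G)}"] by auto
  then have "proper_coloring G (card (pverts G)) f"
    using assms(2) by (auto simp: proper_coloring_def bij_betw_def dest!: inj_onD)
  then show ?thesis by blast
qed

lemma chromatic_number_le_iff:
  assumes "finite (pverts G)"
    and "\<And>u v. (u, v) \<in> parcs G \<Longrightarrow> u \<in> pverts G \<and> v \<in> pverts G \<and> u \<noteq> v"
  shows "chromatic_number G \<le> k \<longleftrightarrow> (\<exists>f. proper_coloring G k f)"
proof -
  have "\<exists>f. proper_coloring G (chromatic_number G) f"
    unfolding chromatic_number_def by (rule LeastI_ex[OF ex_proper_coloring[OF assms]])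
  moreover have "chromatic_number G \<le> k" if "\<exists>f. proper_coloring G k f"
    unfolding chromatic_number_def using that by (rule Least_le)
  ultimately show ?thesis
    using proper_coloring_mono by blast
qed

text \<open>Separates vertices from copy numbers, the form in which both directions of the
  correspondence use the product.\<close>

lemma proper_coloring_lex_product_iff:
  "proper_coloring (lex_product_complete G c) k f \<longleftrightarrow>
    (\<forall>v\<in>pverts G. \<forall>a\<in>{1..c}. f (v, a) \<in> {1..k}) \<and>
    (\<forall>u\<in>pverts G. \<forall>v\<in>pverts G. \<forall>a\<in>{1..c}. \<forall>a'\<in>{1..c}.
      (u, a) \<noteq> (v, a') \<longrightarrow> (u, v) \<in> parcs G \<or> u = v \<longrightarrow> f (u, a) \<noteq> f (v, a'))"
  unfolding proper_coloring_def lex_product_complete_def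
  by (simp add: image_subset_iff Ball_def del: atLeastAtMost_iff) blast

lemma ex_coloring_of_cover_family:
  assumes "finite (pverts G)" and "pverts G \<noteq> {}" and "has_cover_family G b (b + c)"
  shows "\<exists>f. proper_coloring (lex_product_complete G c) (b + c) f"
proof -
  obtain S where cover: "\<forall>i\<in>{1..b + c}. vertex_cover G (S i)" and bud: "budget G (b + c) S \<le> b"
    using assms(3) by (auto simp: has_cover_family_def)
  \<comment> \<open>The colors available at \<open>v\<close>. The budget excludes at most
    \<open>b\<close> of the \<open>b + c\<close> indices, so at least \<open>c\<close> remain and
    the copies of \<open>v\<close> can be mapped injectively into them.\<close>
  define N where "N v = {i \<in> {1..b + c}. v \<notin> S i}" for v
  have "\<exists>g. inj_on g {1..c} \<and> g ` {1..c} \<subseteq> N v" if "v \<in> pverts G" for v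
  proof -
    have "N v = {1..b + c} - {i \<in> {1..b + c}. v \<in> S i}"
      by (auto simp: N_def)
    moreover have "{i \<in> {1..b + c}. v \<in> S i} \<subseteq> {1..b + c}"
      by blast
    ultimately have "card (N v) = b + c - card {i \<in> {1..b + c}. v \<in> S i}"
      by (metis card_Diff_subset card_atLeastAtMost diff_Suc_1 finite_atLeastAtMost finite_subset)
    then have "card {1..c} \<le> card (N v)"
      using bud that by (fastforce simp: budget_le_iff[OF assms(1,2)])
    moreover have "finite (N v)"
      by (simp add: N_def)
    ultimately show ?thesis
      by (metis card_le_inj finite_atLeastAtMost)
  qed
  then obtain g where g: "\<And>v. v \<in> pverts G \<Longrightarrow> inj_on (g v) {1..c} \<and> g v ` {1..c} \<subseteq> N v"
    by metis
  have g_N: "g v a \<in> N v" if "v \<in> pverts G" "a \<in> {1..c}" for v a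
    using g that by blast
  have "g u a \<noteq> g v a'"
    if "u \<in> pverts G" "v \<in> pverts G" "a \<in> {1..c}" "a' \<in> {1..c}" "(u, a) \<noteq> (v, a')"
      "(u, v) \<in> parcs G \<or> u = v" for u v a a'
  proof (cases "u = v")
    \<comment> \<open>Two copies of one vertex differ in the copy number, so injectivity of
      \<open>g v\<close> separates them.\<close>
    case True
    then show ?thesis
      using g[of v] that by (auto dest: inj_onD)
  next
    case False
    \<comment> \<open>A color shared by \<open>u\<close> and \<open>v\<close> would be the index of
      a cover that misses both ends of this arc.\<close>
    then have "(u, v) \<in> parcs G"
      using that by blast
    then show ?thesis
      using g_N[of u a] g_N[of v a'] that(1-4) cover vertex_cover_arc
      by (metis (no_types, lifting) N_def mem_Collect_eq)
  qed
  then have "proper_coloring (lex_product_complete G c) (b + c) (\<lambda>(v, a). g v a)"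
    unfolding proper_coloring_lex_product_iff using g_N by (simp add: N_def)
  then show ?thesis by blast
qed

lemma has_cover_family_of_coloring:
  assumes "finite (pverts G)" and "pverts G \<noteq> {}" and "\<And>v. (v, v) \<notin> parcs G"
    and "proper_coloring (lex_product_complete G c) (b + c) f"
  shows "has_cover_family G b (b + c)"
proof -
  have range: "f (v, a) \<in> {1..b + c}" if "v \<in> pverts G" "a \<in> {1..c}" for v a
    using assms(4) that unfolding proper_coloring_lex_product_iff by blast
  have proper: "f (u, a) \<noteq> f (v, a')"
    if "u \<in> pverts G" "v \<in> pverts G" "a \<in> {1..c}" "a' \<in> {1..c}" "(u, a) \<noteq> (v, a')"
      "(u, v) \<in> parcs G \<or> u = v" for u v a a'
    using assms(4) that unfolding proper_coloring_lex_product_iff by blast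
  \<comment> \<open>The complement of color class \<open>i\<close>, where a vertex belongs to the
    class as soon as one of its copies has color \<open>i\<close>.\<close>
  define S where "S i = {v \<in> pverts G. i \<notin> (\<lambda>a. f (v, a)) ` {1..c}}" for i
  have "vertex_cover G (S i)" for i
  proof -
    have "(u, v) \<notin> parcs G" if ends: "u \<in> pverts G - S i" "v \<in> pverts G - S i" for u v
    proof
      assume arc: "(u, v) \<in> parcs G"
      \<comment> \<open>The copy numbers \<open>a\<close> and \<open>a'\<close> found below may
        coincide, so it is the absence of loops that makes \<open>(u, a)\<close> and
        \<open>(v, a')\<close> distinct.\<close>
      then have "u \<noteq> v"
        using assms(3) by blast
      have "i \<in> (\<lambda>a. f (u, a)) ` {1..c}" "i \<in> (\<lambda>a. f (v, a)) ` {1..c}"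
        using ends by (simp_all add: S_def)
      then obtain a a' where "a \<in> {1..c}" "a' \<in> {1..c}" "f (u, a) = i" "f (v, a') = i"
        by (elim imageE) simp
      then show False
        using proper[of u v a a'] \<open>u \<noteq> v\<close> arc ends by auto
    qed
    then show ?thesis
      by (auto simp: vertex_cover_def independent_set_def S_def)
  qed
  moreover have "card {i \<in> {1..b + c}. v \<in> S i} \<le> b" if "v \<in> pverts G" for v
  proof -
    \<comment> \<open>The copies of \<open>v\<close> form a clique in the product, so they use
      exactly \<open>c\<close> colors and \<open>v\<close> lies in the covers of the other
      \<open>b\<close>.\<close>
    have "inj_on (\<lambda>a. f (v, a)) {1..c}"
      using proper[OF that that] by (intro inj_onI) blast
    then have "card ((\<lambda>a. f (v, a)) ` {1..c}) = c"
      by (simp add: card_image)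
    moreover have "{i \<in> {1..b + c}. v \<in> S i} = {1..b + c} - (\<lambda>a. f (v, a)) ` {1..c}"
      using that by (auto simp: S_def)
    moreover have "(\<lambda>a. f (v, a)) ` {1..c} \<subseteq> {1..b + c}"
      using range[OF that] by blast
    ultimately show ?thesis
      by (simp add: card_Diff_subset)
  qed
  ultimately show ?thesis
    unfolding has_cover_family_def budget_le_iff[OF assms(1,2)] by blast
qed

theorem theorem6:
  fixes G :: "'a pair_pre_digraph" and b c :: nat
  assumes "pair_graph G"
    and "Digraph_Component.connected (with_proj G)"
    and "parcs G \<noteq> {}"
    and "b \<ge> 1" and "c \<ge> 1"
  shows "max_covers G b \<ge> b + c \<longleftrightarrow> fold_chromatic_number c G \<le> b + c"
proof -
  interpret pair_graph G by fact
  obtain u v where arc: "(u, v) \<in> parcs G"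
    using assms(3) by auto
  then have uv: "u \<in> pverts G" "v \<in> pverts G"
    using in_arcsD1 in_arcsD2 by blast+
  then have ne: "pverts G \<noteq> {}"
    by blast
  have fin: "finite (pverts G)"
    by simp
  have loopfree: "(w, w) \<notin> parcs G" for w
    using no_loops by fastforce
  \<comment> \<open>The product has finitely many vertices, and its definition only admits arcs
    between distinct ones, so its chromatic number is attained.\<close>
  have "fold_chromatic_number c G \<le> b + c \<longleftrightarrow>
      (\<exists>f. proper_coloring (lex_product_complete G c) (b + c) f)"
    unfolding fold_chromatic_number_def
    by (rule chromatic_number_le_iff) (use fin in \<open>auto simp: lex_product_complete_def\<close>)
  also have "\<dots> \<longleftrightarrow> has_cover_family G b (b + c)"
    using ex_coloring_of_cover_family[OF fin ne] has_cover_family_of_coloring[OF fin ne loopfree]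
    by blast
  also have "\<dots> \<longleftrightarrow> max_covers G b \<ge> b + c"
    by (rule max_covers_ge_iff[OF fin arc uv, symmetric])
  finally show ?thesis by blast
qed

end
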